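(* The sequence $\mathcal K=\{\mathcal K_n\}_{n\ge1}$ of homogeneous components of the Hopf kernel of $\mathsf D$ is a non-symmetric suboperad of $\mathcal A$, in the sense that it is closed under the structure maps: $\mathcal K_n\circ_i\mathcal K_m\subseteq\mathcal K_{n+m-1}$ for all $n,m\ge1$ and $1\le i\le n$.
   Context: $\Bbbk$ is a commutative ring; "space" means $\Bbbk$-module. $[n]=\{1,\dots,n\}$; a permutation $\sigma\in S_n$ is written as the list $(\sigma_1,\dots,\sigma_n)$ of its values. For a sequence $a$ of $n$ distinct integers, $\mathrm{st}(a)\in S_n$ is the unique permutation with $\mathrm{st}(a)_p<\mathrm{st}(a)_q\iff a_p<a_q$. Operad. $\mathcal A_n:=\Bbbk S_n$ has basis $\{F_\sigma\}_{\sigma\in S_n}$. For $\sigma\in S_n,\tau\in S_m,i\in[n]$, $B_i(\sigma,\tau):=(a_1,\dots,a_{i-1},b_1,\dots,b_m,a_{i+1},\dots,a_n)\in S_{n+m-1}$, where $a_j=\sigma_j$ if $\sigma_j<\sigma_i$, $a_j=\sigma_j+m-1$ if $\sigma_j>\sigma_i$, and $b_k=\tau_k+\sigma_i-1$. The linear maps $\circ_i:\mathcal A_n\otimes\mathcal A_m\to\mathcal A_{n+m-1}$ are $F_\sigma\circ_iF_\tau=F_{B_i(\sigma,\tau)}$ (the non-symmetric associative operad $\mathcal A$). Coproduct on $\bigoplus_{n\ge1}\Bbbk S_n$: for $\sigma\in S_n$, $\Delta(F_\sigma)=\sum_{i=1}^{n-1}F_{\mathrm{st}(\sigma_1,\dots,\sigma_i)}\otimes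 F_{\mathrm{st}(\sigma_{i+1},\dots,\sigma_n)}$. Descent map. $Q_n$ is the set of subsets of $[n-1]$ and $\Bbbk Q_n$ has basis $\{F_{\mathsf S}\}_{\mathsf S\subseteq[n-1]}$. $\mathrm{Des}(\sigma)=\{p\in[n-1]:\sigma_p>\sigma_{p+1}\}$, and $\mathsf D:\bigoplus_{n\ge1}\Bbbk S_n\to\bigoplus_{n\ge1}\Bbbk Q_n$ is the linear map $\mathsf D(F_\sigma)=F_{\mathrm{Des}(\sigma)}$. Hopf kernel. $\mathcal K_*:=\ker(\mathsf D)\cap\ker\bigl((\mathrm{id}\otimes\mathsf D)\circ\Delta\bigr)\subseteq\bigoplus_{n\ge1}\Bbbk S_n$, and $\mathcal K_n:=\mathcal K_*\cap\Bbbk S_n$. *)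

theory Defs
  imports "HOL-Library.Poly_Mapping" "HOL-Combinatorics.Multiset_Permutations"
begin

text \<open>
  The free \<open>'k\<close>-module on a set \<open>X\<close> of elements of type \<open>'b\<close> is rendered as the finitely
  supported functions \<open>x :: 'b \<Rightarrow>\<^sub>0 'k\<close> with \<open>keys x \<subseteq> X\<close>; the tensor product of the free modules
  on \<open>X\<close> and \<open>Y\<close> is the free module on \<open>X \<times> Y\<close>.  Commutative rings are taken in the sort
  \<open>{comm_ring, comm_monoid_mult}\<close>, which unlike \<open>comm_ring_1\<close> does not exclude the zero ring.
\<close>

section \<open>Free modules\<close>

definition basis :: "'b \<Rightarrow> ('b \<Rightarrow>\<^sub>0 'k::{comm_ring, comm_monoid_mult})" where
  "basis b = Poly_Mapping.single b 1"

definition scale :: "'k::{comm_ring, comm_monoid_mult} \<Rightarrow> ('b \<Rightarrow>\<^sub>0 'k) \<Rightarrow> ('b \<Rightarrow>\<^sub>0 'k)" where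
  "scale c x = Poly_Mapping.map ((*) c) x"

text \<open>The linear map with prescribed values \<open>f b\<close> on the basis.\<close>

definition lin_ext ::
  "('b \<Rightarrow> ('c \<Rightarrow>\<^sub>0 'k)) \<Rightarrow> ('b \<Rightarrow>\<^sub>0 'k::{comm_ring, comm_monoid_mult}) \<Rightarrow> ('c \<Rightarrow>\<^sub>0 'k)" where
  "lin_ext f x = (\<Sum>b\<in>Poly_Mapping.keys x. scale (Poly_Mapping.lookup x b) (f b))"

definition tensor ::
  "('b \<Rightarrow>\<^sub>0 'k::{comm_ring, comm_monoid_mult}) \<Rightarrow> ('c \<Rightarrow>\<^sub>0 'k) \<Rightarrow> ('b \<times> 'c \<Rightarrow>\<^sub>0 'k)" where
  "tensor x y = lin_ext (\<lambda>b. lin_ext (\<lambda>c. basis (b, c)) y) x"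

text \<open>The tensor product of two linear maps.\<close>

definition tensor_map ::
  "(('b \<Rightarrow>\<^sub>0 'k) \<Rightarrow> ('d \<Rightarrow>\<^sub>0 'k)) \<Rightarrow> (('c \<Rightarrow>\<^sub>0 'k) \<Rightarrow> ('e \<Rightarrow>\<^sub>0 'k))
     \<Rightarrow> ('b \<times> 'c \<Rightarrow>\<^sub>0 'k::{comm_ring, comm_monoid_mult}) \<Rightarrow> ('d \<times> 'e \<Rightarrow>\<^sub>0 'k)" where
  "tensor_map f g = lin_ext (\<lambda>(b, c). tensor (f (basis b)) (g (basis c)))"

lemma lookup_scale: "Poly_Mapping.lookup (scale c x) b = c * Poly_Mapping.lookup x b"
  by (auto simp: scale_def Poly_Mapping.map.rep_eq when_def)

lemma lookup_lin_ext: "Poly_Mapping.lookup (lin_ext f x) c =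
     (\<Sum>b\<in>Poly_Mapping.keys x. Poly_Mapping.lookup x b * Poly_Mapping.lookup (f b) c)"
  by (simp add: lin_ext_def lookup_sum lookup_scale)

lemma lookup_lin_ext_superset:
  assumes "finite A" "Poly_Mapping.keys x \<subseteq> A"
  shows "Poly_Mapping.lookup (lin_ext f x) c =
     (\<Sum>b\<in>A. Poly_Mapping.lookup x b * Poly_Mapping.lookup (f b) c)"
  unfolding lookup_lin_ext using assms
  by (intro sum.mono_neutral_left) (auto simp: in_keys_iff)

lemma lin_ext_add: "lin_ext f (x + y) = lin_ext f x + lin_ext f y"
proof (rule poly_mapping_eqI)
  fix c
  let ?A = "Poly_Mapping.keys x \<union> Poly_Mapping.keys y"
  have A: "finite ?A" "Poly_Mapping.keys x \<subseteq> ?A" "Poly_Mapping.keys y \<subseteq> ?A"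
    "Poly_Mapping.keys (x + y) \<subseteq> ?A"
    using keys_add[of x y] by auto
  show "Poly_Mapping.lookup (lin_ext f (x + y)) c = Poly_Mapping.lookup (lin_ext f x + lin_ext f y) c"
    unfolding lookup_add lookup_lin_ext_superset[OF A(1,2)] lookup_lin_ext_superset[OF A(1,3)]
      lookup_lin_ext_superset[OF A(1,4)]
    by (simp add: lookup_add distrib_right sum.distrib)
qed

lemma lin_ext_scale: "lin_ext f (scale c x) = scale c (lin_ext f x)"
proof (rule poly_mapping_eqI)
  fix d
  have A: "finite (Poly_Mapping.keys x)" "Poly_Mapping.keys (scale c x) \<subseteq> Poly_Mapping.keys x"
    by (auto simp: in_keys_iff lookup_scale)
  show "Poly_Mapping.lookup (lin_ext f (scale c x)) d = Poly_Mapping.lookup (scale c (lin_ext f x)) d"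
    unfolding lookup_lin_ext_superset[OF A]
    by (simp add: lookup_scale lookup_lin_ext sum_distrib_left mult.assoc)
qed

lemma lin_ext_basis: "lin_ext f (basis b) = f b"
proof (rule poly_mapping_eqI)
  fix c
  have A: "finite {b}" "Poly_Mapping.keys (basis b) \<subseteq> {b}"
    by (auto simp: basis_def)
  show "Poly_Mapping.lookup (lin_ext f (basis b)) c = Poly_Mapping.lookup (f b) c"
    unfolding lookup_lin_ext_superset[OF A] by (simp add: basis_def)
qed

lemma tensor_basis: "tensor (basis b) (basis c) = basis (b, c)"
  by (simp add: tensor_def lin_ext_basis)

section \<open>Permutations as lists of values\<close>

abbreviation perms :: "nat \<Rightarrow> nat list set" where
  "perms n \<equiv> permutations_of_set {1..n}"

text \<open>List positions in HOL start at 0, so the entry written \<open>\<sigma>\<^sub>p\<close> is \<open>\<sigma> ! (p - 1)\<close>.\<close>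

definition st :: "'a::linorder list \<Rightarrow> nat list" where
  "st a = (THE t. t \<in> perms (length a) \<and>
     (\<forall>p<length a. \<forall>q<length a. t ! p < t ! q \<longleftrightarrow> a ! p < a ! q))"

definition block_insert :: "nat \<Rightarrow> nat list \<Rightarrow> nat list \<Rightarrow> nat list" where
  "block_insert i \<sigma> \<tau> =
     (let s = \<sigma> ! (i - 1); m = length \<tau>; a = (\<lambda>v. if v < s then v else v + m - 1)
      in map a (take (i - 1) \<sigma>) @ map (\<lambda>t. t + s - 1) \<tau> @ map a (drop i \<sigma>))"

definition Des :: "nat list \<Rightarrow> nat set" where
  "Des \<sigma> = {p \<in> {1..length \<sigma> - 1}. \<sigma> ! (p - 1) > \<sigma> ! p}"

lemma length_perms: "t \<in> perms n \<Longrightarrow> length t = n"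
  by (metis permutations_of_setD distinct_card card_atLeastAtMost diff_Suc_1)

lemma perms_value_eq_rank:
  assumes t: "t \<in> perms n" and p: "p < n"
  shows "t ! p = card {q. q < n \<and> t ! q \<le> t ! p}"
proof -
  have len: "length t = n" and d: "distinct t" and s: "set t = {1..n}"
    using t by (auto simp: length_perms permutations_of_setD)
  have mem: "t ! p \<in> {1..n}" using p len s nth_mem by metis
  have "inj_on ((!) t) {q. q < n \<and> t ! q \<le> t ! p}"
    using d len by (auto simp: inj_on_def nth_eq_iff_index_eq)
  moreover have "(!) t ` {q. q < n \<and> t ! q \<le> t ! p} = {1..t ! p}"
  proof (intro equalityI subsetI)
    fix v assume "v \<in> (!) t ` {q. q < n \<and> t ! q \<le> t ! p}"
    then show "v \<in> {1..t ! p}" using s len nth_mem by fastforce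
  next
    fix v assume v: "v \<in> {1..t ! p}"
    then have "v \<in> set t" using mem s by auto
    then show "v \<in> (!) t ` {q. q < n \<and> t ! q \<le> t ! p}"
      using v len by (auto simp: in_set_conv_nth)
  qed
  ultimately show ?thesis by (metis card_image card_atLeastAtMost diff_Suc_1)
qed

text \<open>For a sequence of distinct entries, the description in \<^const>\<open>st\<close> is a proper one.\<close>

lemma st_ex1:
  assumes d: "distinct (a :: 'a::linorder list)"
  shows "\<exists>!t. t \<in> perms (length a) \<and>
     (\<forall>p<length a. \<forall>q<length a. t ! p < t ! q \<longleftrightarrow> a ! p < a ! q)" (is "\<exists>!t. ?P t")
proof (rule ex_ex1I)
  define r where "r v = card {w \<in> set a. w \<le> v}" for v
  have mono: "r v < r w" if "v < w" "w \<in> set a" for v w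
    unfolding r_def
  proof (intro psubset_card_mono psubsetI)
    show "{x \<in> set a. x \<le> v} \<noteq> {x \<in> set a. x \<le> w}"
      using that by (metis (mono_tags, lifting) leD mem_Collect_eq order_refl)
  qed (use that in auto)
  have iff: "r v < r w \<longleftrightarrow> v < w" if "v \<in> set a" "w \<in> set a" for v w
    using mono[of v w] mono[of w v] that by (metis linorder_less_linear order_less_asym order_less_irrefl)
  have inj: "inj_on r (set a)"
    using mono by (metis inj_onI linorder_less_linear order_less_irrefl)
  have "r ` set a \<subseteq> {1..length a}"
  proof
    fix k assume "k \<in> r ` set a"
    then obtain v where v: "v \<in> set a" "k = r v" by auto
    have "card {w \<in> set a. w \<le> v} \<le> card (set a)" by (intro card_mono) auto
    moreover have "card {w \<in> set a. w \<le> v} > 0" using v by (subst card_gt_0_iff) auto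
    ultimately show "k \<in> {1..length a}" using v d by (auto simp: r_def distinct_card)
  qed
  moreover have "card (r ` set a) = card {1..length a}"
    using inj d by (simp add: card_image distinct_card)
  ultimately have "r ` set a = {1..length a}" by (simp add: card_subset_eq)
  then have "map r a \<in> perms (length a)"
    using inj d by (auto simp: distinct_map)
  then show "\<exists>t. ?P t" using iff by (intro exI[of _ "map r a"]) simp
next
  fix t u assume t: "?P t" and u: "?P u"
  show "t = u"
  proof (rule nth_equalityI)
    show "length t = length u" using t u length_perms by metis
    fix p assume "p < length t"
    then have p: "p < length a" using t length_perms by metis
    have "{q. q < length a \<and> t ! q \<le> t ! p} = {q. q < length a \<and> u ! q \<le> u ! p}"
      using t u p by (auto simp: not_less[symmetric])
    then show "t ! p = u ! p"
      using perms_value_eq_rank[of t _ p] perms_value_eq_rank[of u _ p] t u p by metis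
  qed
qed

lemma block_insert_perms:
  assumes "\<sigma> \<in> perms n" "\<tau> \<in> perms m" "m \<ge> 1" "i \<in> {1..n}"
  shows "block_insert i \<sigma> \<tau> \<in> perms (n + m - 1)"
proof -
  define s where "s = \<sigma> ! (i - 1)"
  define a where "a v = (if v < s then v else v + m - 1)" for v
  have len: "length \<sigma> = n" "length \<tau> = m" using assms length_perms by auto
  have S: "set \<sigma> = {1..n}" "distinct \<sigma>" "set \<tau> = {1..m}" "distinct \<tau>"
    using assms by (auto simp: permutations_of_setD)
  have \<sigma>: "\<sigma> = take (i - 1) \<sigma> @ s # drop i \<sigma>"
    using id_take_nth_drop[of "i - 1" \<sigma>] assms len by (auto simp: s_def)
  let ?L = "take (i - 1) \<sigma>" and ?R = "drop i \<sigma>"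
  have dist: "distinct (?L @ s # ?R)" and un: "set ?L \<union> {s} \<union> set ?R = {1..n}"
    using \<sigma> S(1,2) by (metis, metis Un_insert_right list.simps(15) set_append sup_bot_right Un_insert_left)
  have s: "s \<in> {1..n}" using un by auto
  have eq: "block_insert i \<sigma> \<tau> = map a ?L @ map (\<lambda>t. t + s - 1) \<tau> @ map a ?R"
    unfolding block_insert_def Let_def a_def s_def len by simp
  have LR: "set ?L \<union> set ?R = {1..n} - {s}" using un dist by auto
  have T: "(\<lambda>t. t + s - 1) ` {1..m} = {s..s + m - 1}"
  proof (intro equalityI subsetI)
    fix v assume "v \<in> {s..s + m - 1}"
    then show "v \<in> (\<lambda>t. t + s - 1) ` {1..m}"
      using s assms(3) by (intro image_eqI[of _ _ "v + 1 - s"]) auto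
  qed (use s in auto)
  have A: "a ` ({1..n} - {s}) = {1..n + m - 1} - {s..s + m - 1}"
  proof (intro equalityI subsetI)
    fix v assume v: "v \<in> {1..n + m - 1} - {s..s + m - 1}"
    show "v \<in> a ` ({1..n} - {s})"
    proof (cases "v < s")
      case True then show ?thesis using v s by (intro image_eqI[of _ _ v]) (auto simp: a_def)
    next
      case False then show ?thesis using v s assms(3)
        by (intro image_eqI[of _ _ "v + 1 - m"]) (auto simp: a_def)
    qed
  qed (use s assms(3) in \<open>auto simp: a_def split: if_splits\<close>)
  have set: "set (block_insert i \<sigma> \<tau>) = {1..n + m - 1}"
  proof -
    have "set (block_insert i \<sigma> \<tau>) = a ` (set ?L \<union> set ?R) \<union> (\<lambda>t. t + s - 1) ` {1..m}"
      unfolding eq using S by auto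
    also have "\<dots> = {1..n + m - 1}" unfolding LR A T using s assms(3) by auto
    finally show ?thesis .
  qed
  have "length (block_insert i \<sigma> \<tau>) = n + m - 1"
    unfolding eq using len assms by auto
  then have "distinct (block_insert i \<sigma> \<tau>)" using set by (intro card_distinct) simp
  then show ?thesis using set by auto
qed

section \<open>The operad, the coproduct, the descent map and its Hopf kernel\<close>

text \<open>The underlying modules of the operad and their direct sum over \<open>n \<ge> 1\<close>.\<close>

definition AssOp :: "nat \<Rightarrow> (nat list \<Rightarrow>\<^sub>0 'k::{comm_ring, comm_monoid_mult}) set" where
  "AssOp n = {x. Poly_Mapping.keys x \<subseteq> perms n}"

definition SSym :: "(nat list \<Rightarrow>\<^sub>0 'k::{comm_ring, comm_monoid_mult}) set" where
  "SSym = {x. Poly_Mapping.keys x \<subseteq> (\<Union>n\<in>{1..}. perms n)}"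

text \<open>The degrees \<open>n\<close> and \<open>m\<close> of the two factors are implicit in the lengths of the lists.\<close>

definition ocomp :: "nat \<Rightarrow> (nat list \<Rightarrow>\<^sub>0 'k::{comm_ring, comm_monoid_mult}) \<Rightarrow>
    (nat list \<Rightarrow>\<^sub>0 'k) \<Rightarrow> (nat list \<Rightarrow>\<^sub>0 'k)" where
  "ocomp i x y = lin_ext (\<lambda>\<sigma>. lin_ext (\<lambda>\<tau>. basis (block_insert i \<sigma> \<tau>)) y) x"

definition coprod ::
  "(nat list \<Rightarrow>\<^sub>0 'k::{comm_ring, comm_monoid_mult}) \<Rightarrow> (nat list \<times> nat list \<Rightarrow>\<^sub>0 'k)" where
  "coprod = lin_ext (\<lambda>\<sigma>. \<Sum>i=1..length \<sigma> - 1.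
     tensor (basis (st (take i \<sigma>))) (basis (st (drop i \<sigma>))))"

text \<open>
  The same set \<open>S\<close> indexes different basis elements in different degrees, so the basis of the
  direct sum of the modules on the \<open>Q\<^sub>n\<close> consists of the pairs \<open>(n, S)\<close> with \<open>S \<subseteq> {1..n-1}\<close>.
\<close>

definition Dmap ::
  "(nat list \<Rightarrow>\<^sub>0 'k::{comm_ring, comm_monoid_mult}) \<Rightarrow> (nat \<times> nat set \<Rightarrow>\<^sub>0 'k)" where
  "Dmap = lin_ext (\<lambda>\<sigma>. basis (length \<sigma>, Des \<sigma>))"

definition Hopf_kernel :: "(nat list \<Rightarrow>\<^sub>0 'k::{comm_ring, comm_monoid_mult}) set" where
  "Hopf_kernel = {x \<in> SSym. Dmap x = 0} \<inter> {x \<in> SSym. (tensor_map id Dmap \<circ> coprod) x = 0}"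

definition Hopf_kernel_comp ::
  "nat \<Rightarrow> (nat list \<Rightarrow>\<^sub>0 'k::{comm_ring, comm_monoid_mult}) set" where
  "Hopf_kernel_comp n = Hopf_kernel \<inter> AssOp n"

lemma ocomp_basis: "ocomp i (basis \<sigma>) (basis \<tau>) = basis (block_insert i \<sigma> \<tau>)"
  by (simp add: ocomp_def lin_ext_basis)

end

theory Submission
  imports Defs
begin

text \<open>
  The coproduct is graded by the length of the left factor, so its terms can be tested one cut at
  a time, and the empty left factor accounts for the descent map itself.  Membership of an element
  \<open>x\<close> of degree \<open>n\<close> in the Hopf kernel therefore means that, for each \<open>j < n\<close>, the coefficients
  of \<open>x\<close> sum to zero over the permutations \<open>\<sigma>\<close> with a prescribed order pattern of the first \<open>j\<close>
  entries and a prescribed descent set of the remaining ones (\<open>Hopf_kernel_comp_iff\<close>).  Call this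
  pair of data the cut of \<open>\<sigma>\<close> at \<open>j\<close>.

  Now cut \<open>B = block_insert i \<sigma> \<tau>\<close> at \<open>j\<close>.  Two entries of \<open>B\<close> that both lie in the inserted block
  compare as the corresponding entries of \<open>\<tau>\<close>.  All other pairs compare as in \<open>\<sigma>\<close>, with the whole
  block standing for the one entry that it replaces (\<open>block_insert_less_iff\<close>).  If the cut does
  not go through the block, then for fixed \<open>\<tau>\<close> the cut of \<open>B\<close> depends only on a cut of \<open>\<sigma>\<close>
  (\<open>cut_at_block_insert_outer\<close>), and summing over \<open>\<sigma>\<close> first gives zero because \<open>x\<close> lies in the
  kernel.  If the cut goes through the block, then for fixed \<open>\<sigma>\<close> the cut of \<open>B\<close> depends only on a
  cut of \<open>\<tau>\<close> (\<open>cut_at_block_insert_inner\<close>), and summing over \<open>\<tau>\<close> first gives zero because \<open>y\<close>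
  lies in the kernel.
\<close>

section \<open>Linear extensions\<close>

lemma lin_ext_zero: "lin_ext f 0 = 0"
  by (simp add: lin_ext_def)

lemma lin_ext_cong:
  assumes "\<And>b. b \<in> Poly_Mapping.keys x \<Longrightarrow> f b = g b"
  shows "lin_ext f x = lin_ext g x"
  using assms by (simp add: lin_ext_def)

lemma lin_ext_sum_vec: "lin_ext f (\<Sum>a\<in>A. x a) = (\<Sum>a\<in>A. lin_ext f (x a))"
  by (induction A rule: infinite_finite_induct) (auto simp: lin_ext_zero lin_ext_add)

lemma lin_ext_sum_fun: "lin_ext (\<lambda>b. \<Sum>a\<in>A. f a b) x = (\<Sum>a\<in>A. lin_ext (f a) x)"
  unfolding poly_mapping_eq_iff fun_eq_iff lookup_lin_ext lookup_sum sum_distrib_left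
  by (intro allI sum.swap)

lemma lin_ext_eq_0:
  assumes "\<And>b. b \<in> Poly_Mapping.keys x \<Longrightarrow> f b = 0"
  shows "lin_ext f x = 0"
  using assms by (intro poly_mapping_eqI) (simp add: lookup_lin_ext)

lemma lin_ext_lin_ext: "lin_ext g (lin_ext f x) = lin_ext (\<lambda>b. lin_ext g (f b)) x"
  unfolding lin_ext_def[of f x] lin_ext_sum_vec lin_ext_scale
  by (simp add: lin_ext_def[of "\<lambda>b. lin_ext g (f b)"])

text \<open>
  Commutativity of the scalars is what allows a bilinear extension to be summed in either order.
\<close>

lemma lin_ext_swap:
  "lin_ext (\<lambda>a. lin_ext (f a) y) x = lin_ext (\<lambda>b. lin_ext (\<lambda>a. f a b) x) y"
proof (rule poly_mapping_eqI)
  fix c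
  show "Poly_Mapping.lookup (lin_ext (\<lambda>a. lin_ext (f a) y) x) c
      = Poly_Mapping.lookup (lin_ext (\<lambda>b. lin_ext (\<lambda>a. f a b) x) y) c"
    unfolding lookup_lin_ext sum_distrib_left
    by (subst sum.swap) (intro sum.cong refl mult.left_commute)
qed

lemma keys_lin_ext: "Poly_Mapping.keys (lin_ext f x) \<subseteq> (\<Union>b\<in>Poly_Mapping.keys x. Poly_Mapping.keys (f b))"
proof
  fix c assume "c \<in> Poly_Mapping.keys (lin_ext f x)"
  then have "(\<Sum>b\<in>Poly_Mapping.keys x. Poly_Mapping.lookup x b * Poly_Mapping.lookup (f b) c) \<noteq> 0"
    by (simp add: in_keys_iff lookup_lin_ext)
  then obtain b where "b \<in> Poly_Mapping.keys x" "Poly_Mapping.lookup (f b) c \<noteq> 0"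
    by (metis (no_types, lifting) mult_zero_right sum.neutral)
  then show "c \<in> (\<Union>b\<in>Poly_Mapping.keys x. Poly_Mapping.keys (f b))"
    by (auto simp: in_keys_iff)
qed

definition pushforward ::
  "('b \<Rightarrow> 'c) \<Rightarrow> ('b \<Rightarrow>\<^sub>0 'k::{comm_ring, comm_monoid_mult}) \<Rightarrow> ('c \<Rightarrow>\<^sub>0 'k)" where
  "pushforward \<phi> = lin_ext (\<lambda>b. basis (\<phi> b))"

text \<open>
  If \<open>\<psi>\<close> is constant on the fibres of \<open>\<phi>\<close>, it factors as \<open>h \<circ> \<phi>\<close>, and the pushforward along \<open>\<psi>\<close>
  is the image under \<open>h\<close> of the pushforward along \<open>\<phi>\<close>.  This turns the purely combinatorial
  congruences between cuts below into vanishing statements.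
\<close>

lemma pushforward_eq_0_coarser:
  assumes "pushforward \<phi> x = 0"
    and "\<And>a b. a \<in> Poly_Mapping.keys x \<Longrightarrow> b \<in> Poly_Mapping.keys x \<Longrightarrow> \<phi> a = \<phi> b \<Longrightarrow> \<psi> a = \<psi> b"
  shows "pushforward \<psi> x = 0"
proof -
  define h where "h c = \<psi> (SOME a. a \<in> Poly_Mapping.keys x \<and> \<phi> a = c)" for c
  have h: "h (\<phi> a) = \<psi> a" if "a \<in> Poly_Mapping.keys x" for a
    unfolding h_def by (rule someI2[where a = a], simp add: that, erule conjE, erule assms(2)[OF _ that])
  have "pushforward \<psi> x = lin_ext (\<lambda>a. lin_ext (\<lambda>c. basis (h c)) (basis (\<phi> a))) x"
    unfolding pushforward_def by (rule lin_ext_cong) (simp add: lin_ext_basis h)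
  also have "\<dots> = lin_ext (\<lambda>c. basis (h c)) (pushforward \<phi> x)"
    by (simp add: lin_ext_lin_ext pushforward_def)
  finally show ?thesis using assms(1) by (simp add: lin_ext_zero)
qed

lemma pushforward_eq_0_cong:
  assumes "\<And>a b. a \<in> Poly_Mapping.keys x \<Longrightarrow> b \<in> Poly_Mapping.keys x \<Longrightarrow> \<phi> a = \<phi> b \<longleftrightarrow> \<psi> a = \<psi> b"
  shows "pushforward \<phi> x = 0 \<longleftrightarrow> pushforward \<psi> x = 0"
  by (rule iffI; erule pushforward_eq_0_coarser; simp add: assms)

text \<open>
  The tag \<open>t\<close> recovers \<open>j\<close> from the basis elements in the \<open>j\<close>-th summand, so the summands have
  disjoint supports and cannot cancel each other.  For the coproduct, the tag is the length of the
  left tensor factor.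
\<close>

lemma sum_pushforward_eq_0_iff:
  assumes "finite J"
    and tag: "\<And>j a. j \<in> J \<Longrightarrow> a \<in> Poly_Mapping.keys x \<Longrightarrow> t (\<phi> j a) = j"
  shows "(\<Sum>j\<in>J. pushforward (\<phi> j) x) = 0 \<longleftrightarrow> (\<forall>j\<in>J. pushforward (\<phi> j) x = 0)"
proof
  assume 0: "(\<Sum>j\<in>J. pushforward (\<phi> j) x) = 0"
  have off: "Poly_Mapping.lookup (pushforward (\<phi> j) x) c = 0" if "j \<in> J" "t c \<noteq> j" for j c
    using that tag unfolding pushforward_def lookup_lin_ext
    by (intro sum.neutral) (auto simp: basis_def lookup_single when_def)
  show "\<forall>j\<in>J. pushforward (\<phi> j) x = 0"
  proof (intro ballI poly_mapping_eqI)
    fix j c assume j: "j \<in> J"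
    show "Poly_Mapping.lookup (pushforward (\<phi> j) x) c = Poly_Mapping.lookup 0 c"
    proof (cases "t c = j")
      case True
      have "(\<Sum>l\<in>J. Poly_Mapping.lookup (pushforward (\<phi> l) x) c)
          = (\<Sum>l\<in>{j}. Poly_Mapping.lookup (pushforward (\<phi> l) x) c)"
        using assms(1) j off[of _ c] True by (intro sum.mono_neutral_right) auto
      moreover have "(\<Sum>l\<in>J. Poly_Mapping.lookup (pushforward (\<phi> l) x) c) = 0"
        using 0 by (simp flip: lookup_sum)
      ultimately show ?thesis by simp
    qed (use j off in simp)
  qed
qed simp

section \<open>The kernel in terms of cuts\<close>

lemma distinct_perms: "t \<in> perms n \<Longrightarrow> distinct t"
  by (rule permutations_of_setD)

lemma AssOp_keysD: "x \<in> AssOp n \<Longrightarrow> \<sigma> \<in> Poly_Mapping.keys x \<Longrightarrow> \<sigma> \<in> perms n"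
  unfolding AssOp_def by blast

lemma st_perms: "distinct a \<Longrightarrow> st a \<in> perms (length a)"
  and st_nth_less_iff: "distinct a \<Longrightarrow> p < length a \<Longrightarrow> q < length a \<Longrightarrow>
    st a ! p < st a ! q \<longleftrightarrow> a ! p < a ! q"
  using theI'[OF st_ex1, of a] unfolding st_def by blast+

lemma length_st: "distinct a \<Longrightarrow> length (st a) = length a"
  using st_perms length_perms by blast

lemma st_eq_iff:
  assumes "distinct a" "distinct b" "length a = length b"
  shows "st a = st b \<longleftrightarrow> (\<forall>p<length a. \<forall>q<length a. a ! p < a ! q \<longleftrightarrow> b ! p < b ! q)"
proof
  assume "st a = st b"
  then show "\<forall>p<length a. \<forall>q<length a. a ! p < a ! q \<longleftrightarrow> b ! p < b ! q"
    using assms st_nth_less_iff by metis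
next
  assume *: "\<forall>p<length a. \<forall>q<length a. a ! p < a ! q \<longleftrightarrow> b ! p < b ! q"
  show "st a = st b"
    using st_ex1[OF assms(1)] st_perms[OF assms(1)] st_perms[OF assms(2)]
      st_nth_less_iff[OF assms(1)] st_nth_less_iff[OF assms(2)] assms(3) *
    by (metis (no_types, lifting))
qed

text \<open>
  Standardization on the right of a cut is invisible to the descent map, which only compares
  neighbours.
\<close>

lemma Des_st:
  assumes "distinct a"
  shows "Des (st a) = Des a"
  using assms by (auto simp: Des_def length_st st_nth_less_iff)

lemma Des_eq_iff:
  assumes "length a = length b"
  shows "Des a = Des b \<longleftrightarrow> (\<forall>p. Suc p < length a \<longrightarrow> (a ! Suc p < a ! p \<longleftrightarrow> b ! Suc p < b ! p))"
proof -
  have *: "Suc p \<in> Des c \<longleftrightarrow> Suc p < length c \<and> c ! Suc p < c ! p" for p c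
    by (auto simp: Des_def)
  have "0 \<notin> Des c" for c by (simp add: Des_def)
  then have "Des a = Des b \<longleftrightarrow> (\<forall>p. Suc p \<in> Des a \<longleftrightarrow> Suc p \<in> Des b)"
    by (metis not0_implies_Suc set_eqI)
  then show ?thesis using assms by (auto simp: *)
qed

text \<open>
  The index in the expansion of \<open>(id \<otimes> D) \<Delta>\<close> contributed by the cut after the first \<open>j\<close> letters;
  the degree of the right factor is left out since \<open>j\<close> and the degree of \<open>\<sigma>\<close> determine it.  For
  \<open>j = 0\<close> the left factor is the empty list and only the descent set of \<open>\<sigma>\<close> remains.
\<close>

definition cut_at :: "nat \<Rightarrow> nat list \<Rightarrow> nat list \<times> nat set" where
  "cut_at j \<sigma> = (st (take j \<sigma>), Des (drop j \<sigma>))"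

lemma cut_at_eq_iff:
  assumes "distinct \<sigma>" "distinct \<rho>" "length \<sigma> = N" "length \<rho> = N" "j \<le> N"
  shows "cut_at j \<sigma> = cut_at j \<rho> \<longleftrightarrow>
    (\<forall>p<j. \<forall>q<j. \<sigma> ! p < \<sigma> ! q \<longleftrightarrow> \<rho> ! p < \<rho> ! q) \<and>
    (\<forall>p\<ge>j. Suc p < N \<longrightarrow> (\<sigma> ! Suc p < \<sigma> ! p \<longleftrightarrow> \<rho> ! Suc p < \<rho> ! p))"
proof -
  have "st (take j \<sigma>) = st (take j \<rho>) \<longleftrightarrow> (\<forall>p<j. \<forall>q<j. \<sigma> ! p < \<sigma> ! q \<longleftrightarrow> \<rho> ! p < \<rho> ! q)"
    using assms by (subst st_eq_iff) auto
  moreover have "Des (drop j \<sigma>) = Des (drop j \<rho>) \<longleftrightarrow>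
      (\<forall>p\<ge>j. Suc p < N \<longrightarrow> (\<sigma> ! Suc p < \<sigma> ! p \<longleftrightarrow> \<rho> ! Suc p < \<rho> ! p))" (is "_ \<longleftrightarrow> ?R")
  proof -
    have "Des (drop j \<sigma>) = Des (drop j \<rho>) \<longleftrightarrow> (\<forall>p. Suc (j + p) < N \<longrightarrow>
        (\<sigma> ! Suc (j + p) < \<sigma> ! (j + p) \<longleftrightarrow> \<rho> ! Suc (j + p) < \<rho> ! (j + p)))"
      using assms by (subst Des_eq_iff) (auto simp: less_diff_conv2 add.commute)
    also have "\<dots> \<longleftrightarrow> ?R" by (metis le_Suc_ex le_add1)
    finally show ?thesis .
  qed
  ultimately show ?thesis by (simp add: cut_at_def)
qed

lemma tensor_map_coprod:
  assumes "x \<in> AssOp n"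
  shows "tensor_map id Dmap (coprod x) =
    (\<Sum>j=1..n - 1. pushforward (\<lambda>\<sigma>. (st (take j \<sigma>), n - j, Des (drop j \<sigma>))) x)"
proof -
  have "tensor_map id Dmap (coprod x) = lin_ext (\<lambda>\<sigma>. \<Sum>j=1..length \<sigma> - 1.
      basis (st (take j \<sigma>), length (st (drop j \<sigma>)), Des (st (drop j \<sigma>)))) x"
    by (simp add: tensor_map_def coprod_def lin_ext_lin_ext lin_ext_sum_vec tensor_basis
        lin_ext_basis Dmap_def)
  also have "\<dots> = lin_ext (\<lambda>\<sigma>. \<Sum>j=1..n - 1. basis (st (take j \<sigma>), n - j, Des (drop j \<sigma>))) x"
  proof (rule lin_ext_cong)
    fix \<sigma> assume "\<sigma> \<in> Poly_Mapping.keys x"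
    then have "length \<sigma> = n" "distinct \<sigma>"
      using AssOp_keysD[OF assms] length_perms distinct_perms by blast+
    then show "(\<Sum>j=1..length \<sigma> - 1.
        basis (st (take j \<sigma>), length (st (drop j \<sigma>)), Des (st (drop j \<sigma>)))) =
      (\<Sum>j=1..n - 1. basis (st (take j \<sigma>), n - j, Des (drop j \<sigma>)) :: _ \<Rightarrow>\<^sub>0 'a)"
      by (simp add: Des_st length_st)
  qed
  finally show ?thesis by (simp add: lin_ext_sum_fun pushforward_def)
qed

text \<open>
  The condition at \<open>j = 0\<close> is the vanishing of the descent map, and the conditions at
  \<open>1 \<le> j < n\<close> are the homogeneous parts of the condition on the coproduct.
\<close>

lemma Hopf_kernel_comp_iff:
  assumes "n \<ge> 1"
  shows "x \<in> Hopf_kernel_comp n \<longleftrightarrow> x \<in> AssOp n \<and> (\<forall>j<n. pushforward (cut_at j) x = 0)"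
proof (cases "x \<in> AssOp n")
  case True
  have perm: "length \<sigma> = n" "distinct \<sigma>" if "\<sigma> \<in> Poly_Mapping.keys x" for \<sigma>
    by (rule length_perms[OF AssOp_keysD[OF True that]], rule distinct_perms[OF AssOp_keysD[OF True that]])
  have "x \<in> SSym" using True assms by (auto simp: AssOp_def SSym_def)
  then have "x \<in> Hopf_kernel_comp n \<longleftrightarrow> Dmap x = 0 \<and> tensor_map id Dmap (coprod x) = 0"
    using True by (simp add: Hopf_kernel_comp_def Hopf_kernel_def)
  also have "Dmap x = 0 \<longleftrightarrow> pushforward (cut_at 0) x = 0"
    unfolding Dmap_def pushforward_def[symmetric]
    by (rule pushforward_eq_0_cong) (simp add: cut_at_def perm)
  also have "tensor_map id Dmap (coprod x) = 0 \<longleftrightarrow> (\<forall>j\<in>{1..n - 1}.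
      pushforward (\<lambda>\<sigma>. (st (take j \<sigma>), n - j, Des (drop j \<sigma>))) x = 0)"
    unfolding tensor_map_coprod[OF True]
    by (rule sum_pushforward_eq_0_iff[where t = "\<lambda>c. length (fst c)"]) (auto simp: perm length_st)
  also have "\<dots> \<longleftrightarrow> (\<forall>j\<in>{1..n - 1}. pushforward (cut_at j) x = 0)"
    by (intro ball_cong refl pushforward_eq_0_cong) (simp add: cut_at_def)
  also have "pushforward (cut_at 0) x = 0 \<and> \<dots> \<longleftrightarrow> (\<forall>j\<in>insert 0 {1..n - 1}. pushforward (cut_at j) x = 0)"
    by simp
  also have "insert 0 {1..n - 1} = {..<n}" using assms by auto
  finally show ?thesis using True by auto
qed (simp add: Hopf_kernel_comp_def)

section \<open>Cutting an inserted block\<close>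

text \<open>
  For a block of length \<open>m\<close> inserted at position \<open>r\<close>, the position in the outer permutation that
  position \<open>p\<close> of the result comes from; the whole block comes from \<open>r\<close>.  Positions start at 0.
\<close>

definition source :: "nat \<Rightarrow> nat \<Rightarrow> nat \<Rightarrow> nat" where
  "source r m p = (if p < r then p else if p < r + m then r else p + 1 - m)"

lemma block_insert_nth:
  assumes "length \<sigma> = n" "length \<tau> = m" "r < n" "p < n + m - 1"
  shows "block_insert (Suc r) \<sigma> \<tau> ! p =
    (if r \<le> p \<and> p < r + m then \<tau> ! (p - r) + \<sigma> ! r - 1
     else (let v = \<sigma> ! source r m p in if v < \<sigma> ! r then v else v + m - 1))"
proof -
  define a where "a v = (if v < \<sigma> ! r then v else v + m - 1)" for v
  have eq: "block_insert (Suc r) \<sigma> \<tau> =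
      map a (take r \<sigma>) @ map (\<lambda>t. t + \<sigma> ! r - 1) \<tau> @ map a (drop (Suc r) \<sigma>)"
    using assms(2) by (simp add: block_insert_def Let_def a_def)
  consider "p < r" | "r \<le> p" "p < r + m" | "r + m \<le> p" by linarith
  then have "block_insert (Suc r) \<sigma> \<tau> ! p =
      (if r \<le> p \<and> p < r + m then \<tau> ! (p - r) + \<sigma> ! r - 1 else a (\<sigma> ! source r m p))"
  proof cases
    case 2
    then have "p - r < m" by linarith
    then show ?thesis using 2 assms by (simp add: eq nth_append source_def)
  next
    case 3
    then obtain l where p: "p = r + m + l" by (metis le_iff_add)
    then have "p + 1 - m = Suc r + l" "Suc r + l < n" using assms(4) by auto
    then show ?thesis using assms(1-3) by (simp add: eq nth_append source_def p)
  qed (use assms in \<open>simp_all add: eq nth_append source_def\<close>)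
  then show ?thesis by (simp add: a_def Let_def)
qed

text \<open>
  The block occupies an interval of consecutive values around \<open>\<sigma> ! r\<close>, so an entry outside it is
  above or below all of the block according to how the entry of \<open>\<sigma>\<close> at its source compares with
  \<open>\<sigma> ! r\<close>.
\<close>

lemma block_insert_less_iff:
  assumes \<sigma>: "\<sigma> \<in> perms n" and \<tau>: "\<tau> \<in> perms m" and r: "r < n"
    and p: "p < n + m - 1" and q: "q < n + m - 1"
  shows "block_insert (Suc r) \<sigma> \<tau> ! p < block_insert (Suc r) \<sigma> \<tau> ! q \<longleftrightarrow>
    (if (r \<le> p \<and> p < r + m) \<and> (r \<le> q \<and> q < r + m) then \<tau> ! (p - r) < \<tau> ! (q - r)
     else \<sigma> ! source r m p < \<sigma> ! source r m q)"
proof -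
  let ?in = "\<lambda>p. r \<le> p \<and> p < r + m"
  have len: "length \<sigma> = n" "length \<tau> = m" and d: "distinct \<sigma>"
    and "set \<sigma> = {1..n}" "set \<tau> = {1..m}"
    using \<sigma> \<tau> length_perms distinct_perms permutations_of_setD(1) by blast+
  then have vs: "\<sigma> ! r \<ge> 1" and vt: "\<And>k. ?in k \<Longrightarrow> 1 \<le> \<tau> ! (k - r) \<and> \<tau> ! (k - r) \<le> m"
    using r by (metis atLeastAtMost_iff nth_mem,
        metis (no_types, lifting) atLeastAtMost_iff nth_mem less_diff_conv2 add.commute)
  have inside: "source r m k = r" if "?in k" for k
    using that by (simp add: source_def)
  have outside: "\<sigma> ! source r m k \<noteq> \<sigma> ! r" if "\<not> ?in k" "k < n + m - 1" for k
  proof -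
    have "source r m k < n" "source r m k \<noteq> r" using that r by (auto simp: source_def)
    then show ?thesis using d len r by (simp add: nth_eq_iff_index_eq)
  qed
  note nth = block_insert_nth[OF len r]
  consider "?in p" "?in q" | "?in p" "\<not> ?in q" | "\<not> ?in p" "?in q" | "\<not> ?in p" "\<not> ?in q"
    by blast
  then show ?thesis
  proof cases
    case 1
    have "a + \<sigma> ! r - 1 < b + \<sigma> ! r - 1 \<longleftrightarrow> a < b" for a b using vs by linarith
    then show ?thesis unfolding nth[OF p] nth[OF q] using 1 by auto
  next
    case 2
    then show ?thesis unfolding nth[OF p] nth[OF q] Let_def
      using vs vt[of p] outside[of q] q inside[of p] by auto
  next
    case 3
    then show ?thesis unfolding nth[OF p] nth[OF q] Let_def
      using vs vt[of q] outside[of p] p inside[of q] by auto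
  next
    case 4
    then show ?thesis unfolding nth[OF p] nth[OF q] Let_def
      using outside[of p] outside[of q] p q by auto
  qed
qed

text \<open>
  A cut that does not separate letters of the block corresponds under \<open>source\<close> to a cut of the
  outer permutation.  Neighbours on its right come from the same position or from neighbours, so
  their descents are read off from \<open>\<tau>\<close> or from the descents of \<open>\<sigma>\<close> to the right of that cut.
\<close>

lemma cut_at_block_insert_outer:
  assumes \<sigma>: "\<sigma> \<in> perms n" and \<rho>: "\<rho> \<in> perms n" and \<tau>: "\<tau> \<in> perms m" and m: "m \<ge> 1"
    and r: "r < n" and j: "j < n + m - 1" "j \<le> r \<or> r + m \<le> j"
    and eq: "cut_at (source r m j) \<sigma> = cut_at (source r m j) \<rho>"
  shows "cut_at j (block_insert (Suc r) \<sigma> \<tau>) = cut_at j (block_insert (Suc r) \<rho> \<tau>)"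
proof -
  have perms: "block_insert (Suc r) \<sigma> \<tau> \<in> perms (n + m - 1)"
    "block_insert (Suc r) \<rho> \<tau> \<in> perms (n + m - 1)"
    using block_insert_perms[OF _ \<tau> m] \<sigma> \<rho> r by auto
  have "source r m j \<le> n" using j r m by (auto simp: source_def)
  then have left: "\<And>p q. p < source r m j \<Longrightarrow> q < source r m j \<Longrightarrow> \<sigma> ! p < \<sigma> ! q \<longleftrightarrow> \<rho> ! p < \<rho> ! q"
    and right: "\<And>p. p \<ge> source r m j \<Longrightarrow> Suc p < n \<Longrightarrow>
      \<sigma> ! Suc p < \<sigma> ! p \<longleftrightarrow> \<rho> ! Suc p < \<rho> ! p"
    using cut_at_eq_iff[OF distinct_perms[OF \<sigma>] distinct_perms[OF \<rho>]
        length_perms[OF \<sigma>] length_perms[OF \<rho>]] eq by blast+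
  \<comment> \<open>This fails for a cut inside the block, where both sides contain letters from position \<open>r\<close>.\<close>
  have before: "source r m p < source r m j" if "p < j" for p
    using that j m by (auto simp: source_def)
  have after: "source r m p \<ge> source r m j" if "p \<ge> j" for p
    using that j m by (auto simp: source_def)
  have step: "source r m (Suc p) = Suc (source r m p)" "Suc (source r m p) < n"
    if "\<not> ((r \<le> Suc p \<and> Suc p < r + m) \<and> (r \<le> p \<and> p < r + m))" "Suc p < n + m - 1" for p
    using that m r by (auto simp: source_def)
  show ?thesis
  proof (subst cut_at_eq_iff[where N = "n + m - 1"], goal_cases)
    case 6
    show ?case
      using j(1) before after left right step
      by (auto simp: block_insert_less_iff[OF \<sigma> \<tau> r] block_insert_less_iff[OF \<rho> \<tau> r])
  qed (use j(1) perms[THEN distinct_perms] perms[THEN length_perms] in auto)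
qed

text \<open>
  Such a cut has exactly the first \<open>j - r\<close> letters of the block on its left, so \<open>\<tau>\<close> matters only
  through its own cut at \<open>j - r\<close>; all comparisons with a letter outside the block are governed by
  the fixed \<open>\<sigma>\<close>.
\<close>

lemma cut_at_block_insert_inner:
  assumes \<sigma>: "\<sigma> \<in> perms n" and \<tau>: "\<tau> \<in> perms m" and \<theta>: "\<theta> \<in> perms m"
    and r: "r < n" and j: "r \<le> j" "j < r + m"
    and eq: "cut_at (j - r) \<tau> = cut_at (j - r) \<theta>"
  shows "cut_at j (block_insert (Suc r) \<sigma> \<tau>) = cut_at j (block_insert (Suc r) \<sigma> \<theta>)"
proof -
  have m: "m \<ge> 1" using j by simp
  have perms: "block_insert (Suc r) \<sigma> \<tau> \<in> perms (n + m - 1)"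
    "block_insert (Suc r) \<sigma> \<theta> \<in> perms (n + m - 1)"
    using block_insert_perms[OF \<sigma> _ m] \<tau> \<theta> r by auto
  have jN: "j < n + m - 1" using j r by simp
  have left: "\<And>p q. p < j - r \<Longrightarrow> q < j - r \<Longrightarrow> \<tau> ! p < \<tau> ! q \<longleftrightarrow> \<theta> ! p < \<theta> ! q"
    and right: "\<And>p. p \<ge> j - r \<Longrightarrow> Suc p < m \<Longrightarrow> \<tau> ! Suc p < \<tau> ! p \<longleftrightarrow> \<theta> ! Suc p < \<theta> ! p"
    using cut_at_eq_iff[OF distinct_perms[OF \<tau>] distinct_perms[OF \<theta>]
        length_perms[OF \<tau>] length_perms[OF \<theta>], of "j - r"] eq j by auto
  show ?thesis
  proof (subst cut_at_eq_iff[where N = "n + m - 1"], goal_cases)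
    case 6
    have "\<tau> ! (p - r) < \<tau> ! (q - r) \<longleftrightarrow> \<theta> ! (p - r) < \<theta> ! (q - r)"
      if "r \<le> p" "r \<le> q" "p < j" "q < j" for p q
      using that by (intro left) auto
    moreover have "\<tau> ! (Suc p - r) < \<tau> ! (p - r) \<longleftrightarrow> \<theta> ! (Suc p - r) < \<theta> ! (p - r)"
      if "j \<le> p" "Suc p < r + m" for p
      using that right[of "p - r"] j by (simp add: Suc_diff_le)
    ultimately show ?case
      using jN j(1) by (auto simp: block_insert_less_iff[OF \<sigma> \<tau> r] block_insert_less_iff[OF \<sigma> \<theta> r])
  qed (use jN perms[THEN distinct_perms] perms[THEN length_perms] in auto)
qed

section \<open>Closure under the partial compositions\<close>

lemma ocomp_AssOp:
  assumes "x \<in> AssOp n" "y \<in> AssOp m" "m \<ge> 1" "i \<in> {1..n}"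
  shows "ocomp i x y \<in> AssOp (n + m - 1)"
proof -
  have "Poly_Mapping.keys (ocomp i x y) \<subseteq>
      (\<Union>\<sigma>\<in>Poly_Mapping.keys x. \<Union>\<tau>\<in>Poly_Mapping.keys y. {block_insert i \<sigma> \<tau>})"
    unfolding ocomp_def
    by (intro order_trans[OF keys_lin_ext] UN_mono order_refl) (simp add: basis_def)
  also have "\<dots> \<subseteq> perms (n + m - 1)"
    using assms block_insert_perms unfolding AssOp_def by blast
  finally show ?thesis by (simp add: AssOp_def)
qed

lemma pushforward_ocomp:
  "pushforward \<phi> (ocomp i x y) =
    lin_ext (\<lambda>\<sigma>. pushforward (\<lambda>\<tau>. \<phi> (block_insert i \<sigma> \<tau>)) y) x"
  "pushforward \<phi> (ocomp i x y) =
    lin_ext (\<lambda>\<tau>. pushforward (\<lambda>\<sigma>. \<phi> (block_insert i \<sigma> \<tau>)) x) y"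
proof -
  show *: "pushforward \<phi> (ocomp i x y) =
      lin_ext (\<lambda>\<sigma>. pushforward (\<lambda>\<tau>. \<phi> (block_insert i \<sigma> \<tau>)) y) x"
    by (simp add: pushforward_def ocomp_def lin_ext_lin_ext lin_ext_basis)
  show "pushforward \<phi> (ocomp i x y) =
      lin_ext (\<lambda>\<tau>. pushforward (\<lambda>\<sigma>. \<phi> (block_insert i \<sigma> \<tau>)) x) y"
    unfolding * unfolding pushforward_def by (rule lin_ext_swap)
qed

theorem proposition3p7:
  fixes n m i :: nat
  assumes "n \<ge> 1" and "m \<ge> 1" and "1 \<le> i" and "i \<le> n"
  shows "{ocomp i x y | x y. x \<in> (Hopf_kernel_comp n :: (nat list \<Rightarrow>\<^sub>0 'k::{comm_ring, comm_monoid_mult}) set)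
             \<and> y \<in> Hopf_kernel_comp m}
         \<subseteq> Hopf_kernel_comp (n + m - 1)"
proof -
  obtain r where i: "i = Suc r" and r: "r < n" using assms(3,4) by (cases i) auto
  have "ocomp i x y \<in> Hopf_kernel_comp (n + m - 1)"
    if "x \<in> Hopf_kernel_comp n" "y \<in> Hopf_kernel_comp m" for x y :: "nat list \<Rightarrow>\<^sub>0 'k"
  proof -
    have x: "x \<in> AssOp n" "\<And>j. j < n \<Longrightarrow> pushforward (cut_at j) x = 0"
      and y: "y \<in> AssOp m" "\<And>j. j < m \<Longrightarrow> pushforward (cut_at j) y = 0"
      using that assms by (auto simp: Hopf_kernel_comp_iff)
    have kx: "\<sigma> \<in> perms n" if "\<sigma> \<in> Poly_Mapping.keys x" for \<sigma>
      using AssOp_keysD[OF x(1) that] .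
    have ky: "\<tau> \<in> perms m" if "\<tau> \<in> Poly_Mapping.keys y" for \<tau>
      using AssOp_keysD[OF y(1) that] .
    have "pushforward (cut_at j) (ocomp i x y) = 0" if j: "j < n + m - 1" for j
    proof (cases "j \<le> r \<or> r + m \<le> j")
      case True
      then have "source r m j < n" using j r assms(2) by (auto simp: source_def)
      note x0 = x(2)[OF this]
      have "pushforward (\<lambda>\<sigma>. cut_at j (block_insert i \<sigma> \<tau>)) x = 0"
        if "\<tau> \<in> Poly_Mapping.keys y" for \<tau>
        unfolding i by (rule pushforward_eq_0_coarser[OF x0])
          (rule cut_at_block_insert_outer[OF kx kx ky[OF that] assms(2) r j True])
      then show ?thesis unfolding pushforward_ocomp(2) by (rule lin_ext_eq_0)
    next
      case False
      then have rj: "r \<le> j" "j < r + m" by auto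
      then have y0: "pushforward (cut_at (j - r)) y = 0" by (intro y(2)) simp
      have "pushforward (\<lambda>\<tau>. cut_at j (block_insert i \<sigma> \<tau>)) y = 0"
        if "\<sigma> \<in> Poly_Mapping.keys x" for \<sigma>
        unfolding i by (rule pushforward_eq_0_coarser[OF y0])
          (rule cut_at_block_insert_inner[OF kx[OF that] ky ky r rj])
      then show ?thesis unfolding pushforward_ocomp(1) by (rule lin_ext_eq_0)
    qed
    moreover have "ocomp i x y \<in> AssOp (n + m - 1)"
      using x(1) y(1) assms by (intro ocomp_AssOp) auto
    ultimately show ?thesis using assms by (simp add: Hopf_kernel_comp_iff)
  qed
  then show ?thesis by blast
qed

end
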